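(* Let $k\ge 1$, let $\mathbf{A}\in\mathbb{R}^{n\times d}$ be a matrix of rank at least $k$, let $\epsilon>0$, and let $\mathbf{C}$ be the column submatrix of $\mathbf{A}$ selected by the deterministic ridge leverage score (DRLS) algorithm with parameters $k$ and $\epsilon$. Then $$(1-\epsilon)\,\mathbf{A}\mathbf{A}^T-\frac{\epsilon}{k}\,\|\mathbf{A}_{\backslash k}\|_F^2\,\mathbf{I}\;\preceq\;\mathbf{C}\mathbf{C}^T\;\preceq\;\mathbf{A}\mathbf{A}^T .$$
   Context: Notation. $\preceq$ is the Loewner order on symmetric matrices ($\mathbf F\preceq\mathbf G$ iff $\mathbf G-\mathbf F$ is positive semidefinite); $\|\cdot\|_F$ is the Frobenius norm; $\mathbf{M}^+$ is the Moore-Penrose pseudoinverse. For a matrix $\mathbf{M}$, $\mathbf{M}_k$ is its rank-$k$ truncated SVD approximation (keeping the $k$ largest singular values with their singular vectors) and $\mathbf{M}_{\backslash k}=\mathbf{M}-\mathbf{M}_k$. Ridge leverage scores. For $\mathbf{A}\in\mathbb{R}^{n\times d}$ with columns $\mathbf{a}_1,\dots,\mathbf{a}_d$, $$\bar\tau_i(\mathbf{A})=\mathbf{a}_i^T\left(\mathbf{A}\mathbf{A}^T+\tfrac1k\|\mathbf{A}_{\backslash k}\|_F^2\,\mathbf{I}\right)^+\mathbf{a}_i,\qquad \bar t=\sum_{i=1}^d\bar\tau_i(\mathbf{A}).$$ DRLS algorithm (parameters $k$, error tolerance $\epsilon>0$). Sort the columns by $\bar\tau_i(\mathbf{A})$ from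 largest to smallest (ties broken arbitrarily). Starting from the empty set $\Theta$, add column indices to $\Theta$ in this order until $\sum_{i\in\Theta}\bar\tau_i(\mathbf{A})>\bar t-\epsilon$, and then stop. If $|\Theta|<k$, continue adding indices in the same order until $|\Theta|=k$. The output $\mathbf{C}\in\mathbb{R}^{n\times|\Theta|}$ is the submatrix of $\mathbf{A}$ consisting of the (unweighted) columns indexed by $\Theta$; equivalently $\mathbf{C}=\mathbf{A}\mathbf{S}$ with $\mathbf{S}$ the corresponding $d\times|\Theta|$ 0-1 column selection matrix. *)

theory Defs
  imports "HOL-Analysis.Analysis"
begin

text \<open>Real \<open>n\<close>-by-\<open>d\<close> matrices have type \<^typ>\<open>real^'d^'n\<close>.  The library norm on this type
  is the Frobenius norm:\<close>

lemma norm_matrix_Frobenius: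
  fixes M :: "real^'d^'n"
  shows "norm M = sqrt (\<Sum>i\<in>UNIV. \<Sum>j\<in>UNIV. (M $ i $ j)\<^sup>2)"
  by (simp add: norm_vec_def L2_set_def sum_nonneg)


subsection \<open>Loewner order\<close>

definition psd :: "real^'n^'n \<Rightarrow> bool" where
  "psd M \<longleftrightarrow> transpose M = M \<and> (\<forall>x. 0 \<le> x \<bullet> (M *v x))"

definition loewner_le :: "real^'n^'n \<Rightarrow> real^'n^'n \<Rightarrow> bool"  (infix "\<preceq>" 50) where
  "F \<preceq> G \<longleftrightarrow> psd (G - F)"


subsection \<open>Moore-Penrose pseudoinverse\<close>

definition penrose :: "real^'d^'n \<Rightarrow> real^'n^'d \<Rightarrow> bool" where
  "penrose M X \<longleftrightarrow> M ** X ** M = M \<and> X ** M ** X = X \<and>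
     transpose (M ** X) = M ** X \<and> transpose (X ** M) = X ** M"

definition pinv :: "real^'d^'n \<Rightarrow> real^'n^'d" where
  "pinv M = (THE X. penrose M X)"


subsection \<open>Singular value decomposition and truncation\<close>

definition outer :: "real^'n \<Rightarrow> real^'d \<Rightarrow> real^'d^'n" where
  "outer u v = (\<chi> i j. u $ i * v $ j)"

text \<open>Compact form: only the \<open>r\<close> positive singular values are listed, in decreasing order; the
  values of \<open>s\<close>, \<open>u\<close>, \<open>v\<close> at indices \<open>\<ge> r\<close> are irrelevant.\<close>

definition svd ::
  "real^'d^'n \<Rightarrow> nat \<Rightarrow> (nat \<Rightarrow> real) \<Rightarrow> (nat \<Rightarrow> real^'n) \<Rightarrow> (nat \<Rightarrow> real^'d) \<Rightarrow> bool" where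
  "svd M r s u v \<longleftrightarrow>
     (\<forall>i<r. 0 < s i) \<and> (\<forall>i j. i \<le> j \<and> j < r \<longrightarrow> s j \<le> s i) \<and>
     (\<forall>i<r. \<forall>j<r. u i \<bullet> u j = (if i = j then 1 else 0)) \<and>
     (\<forall>i<r. \<forall>j<r. v i \<bullet> v j = (if i = j then 1 else 0)) \<and>
     M = (\<Sum>i<r. s i *\<^sub>R outer (u i) (v i))"

text \<open>A relation rather than a function: if the \<open>k\<close>-th and \<open>(k+1)\<close>-th singular values coincide,
  then the rank-\<open>k\<close> truncation depends on the chosen singular vectors.\<close>

definition truncated_svd :: "nat \<Rightarrow> real^'d^'n \<Rightarrow> real^'d^'n \<Rightarrow> bool" where
  "truncated_svd k M M\<^sub>k \<longleftrightarrow>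
     (\<exists>r s u v. svd M r s u v \<and> M\<^sub>k = (\<Sum>i<min k r. s i *\<^sub>R outer (u i) (v i)))"


subsection \<open>Deterministic ridge leverage score sampling\<close>

text \<open>The argument \<open>A\<^sub>k\<close> is a rank-\<open>k\<close> truncated SVD of \<open>A\<close>, so that \<open>A - A\<^sub>k\<close> is the tail of \<open>A\<close>.\<close>

definition ridge_score :: "nat \<Rightarrow> real^'d^'n \<Rightarrow> real^'d^'n \<Rightarrow> 'd \<Rightarrow> real" where
  "ridge_score k A A\<^sub>k i =
     column i A \<bullet>
       (pinv (A ** transpose A + (1 / real k * (norm (A - A\<^sub>k))\<^sup>2) *\<^sub>R mat 1) *v column i A)"

text \<open>\<open>drls_indices k \<epsilon> \<tau> \<Theta>\<close>: with scores \<open>\<tau>\<close>, the algorithm can output the index set \<open>\<Theta>\<close>.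
  The list \<open>xs\<close> is the sorted order of the columns (ties broken arbitrarily), and \<open>m\<close> is the number
  of columns taken when the partial sum of the scores first exceeds the total score minus \<open>\<epsilon>\<close>.\<close>

definition drls_indices :: "nat \<Rightarrow> real \<Rightarrow> ('d::finite \<Rightarrow> real) \<Rightarrow> 'd set \<Rightarrow> bool" where
  "drls_indices k \<epsilon> \<tau> \<Theta> \<longleftrightarrow>
     (\<exists>xs. distinct xs \<and> set xs = UNIV \<and> sorted_wrt (\<lambda>i j. \<tau> i \<ge> \<tau> j) xs \<and>
       (let m = (LEAST m. (\<Sum>i\<in>set (take m xs). \<tau> i) > (\<Sum>i\<in>UNIV. \<tau> i) - \<epsilon>)
        in \<Theta> = set (take (max m k) xs)))"

text \<open>The columns of \<open>C\<close> are indexed by a finite type \<open>'m\<close> that \<open>\<sigma>\<close> puts in bijection with the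
  selected index set; in particular \<open>CARD('m) = card \<Theta>\<close>.\<close>

definition drls_output ::
  "nat \<Rightarrow> real \<Rightarrow> real^'d^'n \<Rightarrow> real^'d^'n \<Rightarrow> real^'m^'n \<Rightarrow> bool" where
  "drls_output k \<epsilon> A A\<^sub>k C \<longleftrightarrow>
     (\<exists>\<Theta> \<sigma>. drls_indices k \<epsilon> (ridge_score k A A\<^sub>k) \<Theta> \<and>
        bij_betw \<sigma> (UNIV :: 'm set) \<Theta> \<and> C = (\<chi> i j. A $ i $ \<sigma> j))"


subsection \<open>The notions above are well defined\<close>

lemma outer_mult_vec: "outer u v *v x = (v \<bullet> x) *\<^sub>R u"
  by (simp add: outer_def matrix_vector_mult_def inner_vec_def vec_eq_iff sum_distrib_left
      sum_distrib_right mult_ac)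

lemma matrix_sum_mult_vec:
  fixes f :: "'a \<Rightarrow> real^'d^'n"
  shows "finite I \<Longrightarrow> (\<Sum>i\<in>I. f i) *v x = (\<Sum>i\<in>I. f i *v x)"
  by (induction I rule: finite_induct) (simp_all add: matrix_vector_mult_add_rdistrib)

lemma outer_sum_mult_vec:
  fixes r :: nat
  shows "(\<Sum>i<r. c i *\<^sub>R outer (u i) (v i)) *v x = (\<Sum>i<r. (c i * (v i \<bullet> x)) *\<^sub>R u i)"
  by (simp add: matrix_sum_mult_vec scaleR_matrix_vector_assoc[symmetric] outer_mult_vec)

lemma transpose_outer_sum:
  fixes r :: nat
  shows "transpose (\<Sum>i<r. c i *\<^sub>R outer (u i) (v i)) = (\<Sum>i<r. c i *\<^sub>R outer (v i) (u i))"
  by (simp add: vec_eq_iff transpose_def outer_def mult_ac)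

lemma inner_transpose:
  fixes M :: "real^'d^'n"
  shows "(transpose M *v y) \<bullet> x = y \<bullet> (M *v x)"
  by (metis dot_lmul_matrix vector_transpose_matrix transpose_transpose)

lemma top_singular_triple:
  fixes M :: "real^'d^'n"
  assumes "M \<noteq> 0"
  obtains s u v where "0 < s" "norm u = 1" "norm v = 1" "M *v v = s *\<^sub>R u"
    "transpose M *v u = s *\<^sub>R v" "\<And>x. norm (M *v x) \<le> s * norm x"
proof -
  have cont: "continuous_on (sphere 0 1) (\<lambda>x. norm (M *v x))"
    by (intro continuous_intros)
  have ne: "sphere (0::real^'d) 1 \<noteq> {}"
    by simp
  obtain v where v: "v \<in> sphere 0 1" "\<And>x. x \<in> sphere 0 1 \<Longrightarrow> norm (M *v x) \<le> norm (M *v v)"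
    using continuous_attains_sup[OF compact_sphere ne cont] by blast
  define s where "s = norm (M *v v)"
  have bound: "norm (M *v x) \<le> s * norm x" for x
  proof (cases "x = 0")
    case False
    have "norm (M *v ((1 / norm x) *\<^sub>R x)) \<le> s"
      unfolding s_def using False by (intro v(2)) simp
    then show ?thesis
      using False by (simp add: matrix_vector_mult_scaleR field_simps)
  qed simp
  have "s \<noteq> 0"
  proof
    assume "s = 0"
    then have "M *v x = 0 *v x" for x
      using bound[of x] by simp
    then show False
      using assms by (metis matrix_eq)
  qed
  then have s: "0 < s"
    by (simp add: s_def)
  define u where "u = (1 / s) *\<^sub>R (M *v v)"
  have Mv: "M *v v = s *\<^sub>R u" and u: "norm u = 1"
    using s by (auto simp: u_def s_def)
  define w where "w = transpose M *v u"
  have ww: "norm w \<le> s"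
  proof (cases "w = 0")
    case False
    have "(norm w)\<^sup>2 = u \<bullet> (M *v w)"
      by (simp add: w_def inner_transpose power2_norm_eq_inner del: transpose_matrix_vector)
    also have "\<dots> \<le> norm u * norm (M *v w)"
      by (rule norm_cauchy_schwarz)
    also have "\<dots> \<le> s * norm w"
      using bound[of w] u by simp
    finally show ?thesis
      using False by (simp add: power2_eq_square)
  qed (use s in simp)
  have "w \<bullet> v = s"
    using u by (simp add: w_def inner_transpose Mv power2_norm_eq_inner[symmetric]
        del: transpose_matrix_vector)
  moreover have "v \<bullet> v = 1"
    using v(1) by (simp add: dot_square_norm)
  ultimately have "(norm (w - s *\<^sub>R v))\<^sup>2 = (norm w)\<^sup>2 - s\<^sup>2"
    unfolding power2_norm_eq_inner
    by (simp add: inner_diff_left inner_diff_right inner_commute[of v w] power2_eq_square)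
  moreover have "(norm w)\<^sup>2 \<le> s\<^sup>2"
    using ww by (simp add: power_mono)
  ultimately have "(norm (w - s *\<^sub>R v))\<^sup>2 \<le> 0"
    by simp
  then have "w = s *\<^sub>R v"
    by simp
  then show ?thesis
    using that[of s u v] s u v(1) Mv bound by (simp add: w_def)
qed

lemma svd_exists:
  fixes M :: "real^'d^'n"
  shows "\<exists>r s u v. svd M r s u v"
proof (induction "rank M" arbitrary: M rule: less_induct)
  case less
  show ?case
  proof (cases "M = 0")
    case True
    then have "svd M 0 s u v" for s u v
      by (simp add: svd_def)
    then show ?thesis
      by blast
  next
    case False
    then obtain s u v where suv: "0 < s" "norm u = 1" "norm v = 1" "M *v v = s *\<^sub>R u"
        "transpose M *v u = s *\<^sub>R v" and bound: "\<And>x. norm (M *v x) \<le> s * norm x"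
      by (metis top_singular_triple)
    have vv: "v \<bullet> v = 1" and uu: "u \<bullet> u = 1"
      using suv(2,3) by (simp_all add: dot_square_norm)
    define M' where "M' = M - s *\<^sub>R outer u v"
    have M': "M' *v x = M *v x - (s * (v \<bullet> x)) *\<^sub>R u" for x
      by (simp add: M'_def matrix_vector_mult_diff_rdistrib scaleR_matrix_vector_assoc[symmetric]
          outer_mult_vec)
    have M'2: "M' *v x = M *v (x - (v \<bullet> x) *\<^sub>R v)" for x
      by (simp add: M' matrix_vector_mult_diff_distrib matrix_vector_mult_scaleR suv(4) mult.commute)
    have M'v: "M' *v v = 0"
      by (simp add: M' suv(4) vv)
    have uM': "u \<bullet> (M' *v x) = 0" for x
    proof -
      have "u \<bullet> (M *v x) = s * (v \<bullet> x)"
        using inner_transpose[of M u x] by (simp add: suv(5) del: transpose_matrix_vector)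
      then show ?thesis
        by (simp add: M' inner_diff_right uu)
    qed
    have "range ((*v) M') \<subset> range ((*v) M)"
    proof
      show "range ((*v) M') \<subseteq> range ((*v) M)"
        using M'2 by auto
      have "M *v v \<notin> range ((*v) M')"
        using uM' suv(1,4) uu by (metis imageE inner_scaleR_right mult_1_right less_irrefl)
      then show "range ((*v) M') \<noteq> range ((*v) M)"
        by blast
    qed
    moreover have "span (range ((*v) K)) = range ((*v) K)" for K :: "real^'d^'n"
      unfolding span_eq_iff by (simp add: linear_subspace_image)
    ultimately have "rank M' < rank M"
      unfolding rank_dim_range by (intro dim_psubset) (simp only:)
    then obtain r s' u' v' where "svd M' r s' u' v'"
      using less by blast
    then have svd': "\<And>i. i < r \<Longrightarrow> 0 < s' i" "\<And>i j. i \<le> j \<Longrightarrow> j < r \<Longrightarrow> s' j \<le> s' i"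
        "\<And>i j. i < r \<Longrightarrow> j < r \<Longrightarrow> u' i \<bullet> u' j = (if i = j then 1 else 0)"
        "\<And>i j. i < r \<Longrightarrow> j < r \<Longrightarrow> v' i \<bullet> v' j = (if i = j then 1 else 0)"
        "M' = (\<Sum>i<r. s' i *\<^sub>R outer (u' i) (v' i))"
      by (auto simp: svd_def)
    have M'x: "M' *v x = (\<Sum>i<r. (s' i * (v' i \<bullet> x)) *\<^sub>R u' i)" for x
      by (simp add: svd'(5) outer_sum_mult_vec)
    have M'v': "M' *v v' j = s' j *\<^sub>R u' j" if "j < r" for j
    proof -
      have "M' *v v' j = (\<Sum>i<r. if i = j then s' j *\<^sub>R u' j else 0)"
        unfolding M'x using that by (intro sum.cong) (auto simp: svd'(4))
      then show ?thesis
        using that by simp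
    qed
    have u'u: "u \<bullet> u' j = 0" if "j < r" for j
      using uM'[of "v' j"] svd'(1)[OF that] by (simp add: M'v' that)
    have v'v: "v \<bullet> v' j = 0" if "j < r" for j
    proof -
      have "0 = u' j \<bullet> (M' *v v)"
        by (simp add: M'v)
      also have "\<dots> = (\<Sum>i<r. if i = j then s' j * (v' j \<bullet> v) else 0)"
        unfolding M'x inner_sum_right using that by (intro sum.cong) (auto simp: svd'(3))
      also have "\<dots> = s' j * (v' j \<bullet> v)"
        using that by simp
      finally show ?thesis
        using svd'(1)[OF that] by (simp add: inner_commute)
    qed
    have s's: "s' j \<le> s" if "j < r" for j
    proof -
      have "s' j = norm (M' *v v' j)"
        using svd'(1)[OF that] svd'(3)[OF that that] by (simp add: M'v' that norm_eq_sqrt_inner)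
      also have "\<dots> = norm (M *v v' j)"
        by (simp add: M' v'v that)
      also have "\<dots> \<le> s"
        using bound[of "v' j"] svd'(4)[OF that that] by (simp add: norm_eq_sqrt_inner)
      finally show ?thesis .
    qed
    have "M = (\<Sum>i<Suc r. case_nat s s' i *\<^sub>R outer (case_nat u u' i) (case_nat v v' i))"
      unfolding sum.lessThan_Suc_shift by (simp add: svd'(5)[symmetric] M'_def)
    moreover have "\<forall>i<Suc r. 0 < case_nat s s' i"
      using suv(1) svd'(1) by (auto split: nat.split)
    moreover have "\<forall>i j. i \<le> j \<and> j < Suc r \<longrightarrow> case_nat s s' j \<le> case_nat s s' i"
      using svd'(2) s's by (auto split: nat.split)
    moreover have "\<forall>i<Suc r. \<forall>j<Suc r. case_nat u u' i \<bullet> case_nat u u' j = (if i = j then 1 else 0)"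
      using svd'(3) u'u uu by (auto split: nat.split simp: inner_commute)
    moreover have "\<forall>i<Suc r. \<forall>j<Suc r. case_nat v v' i \<bullet> case_nat v v' j = (if i = j then 1 else 0)"
      using svd'(4) v'v vv by (auto split: nat.split simp: inner_commute)
    ultimately have "svd M (Suc r) (case_nat s s') (case_nat u u') (case_nat v v')"
      unfolding svd_def by blast
    then show ?thesis
      by blast
  qed
qed

lemma truncated_svd_exists: "\<exists>M\<^sub>k. truncated_svd k M M\<^sub>k"
  unfolding truncated_svd_def using svd_exists by blast

lemma svd_penrose:
  fixes M :: "real^'d^'n"
  assumes "svd M r s u v"
  shows "penrose M (\<Sum>i<r. inverse (s i) *\<^sub>R outer (v i) (u i))"
proof -
  define X where "X = (\<Sum>i<r. inverse (s i) *\<^sub>R outer (v i) (u i))"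
  have s: "s i \<noteq> 0" if "i < r" for i
    using assms that unfolding svd_def by (metis less_irrefl)
  have uu: "u i \<bullet> u j = (if i = j then 1 else 0)" and vv: "v i \<bullet> v j = (if i = j then 1 else 0)"
    if "i < r" "j < r" for i j
    using assms that by (auto simp: svd_def)
  have M: "M = (\<Sum>i<r. s i *\<^sub>R outer (u i) (v i))"
    using assms by (simp add: svd_def)
  have Mx: "M *v x = (\<Sum>i<r. (s i * (v i \<bullet> x)) *\<^sub>R u i)" for x
    by (simp add: M outer_sum_mult_vec)
  have Xy: "X *v y = (\<Sum>i<r. (inverse (s i) * (u i \<bullet> y)) *\<^sub>R v i)" for y
    by (simp add: X_def outer_sum_mult_vec)
  have uM: "u j \<bullet> (M *v x) = s j * (v j \<bullet> x)" if "j < r" for j x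
  proof -
    have "u j \<bullet> (M *v x) = (\<Sum>i<r. if i = j then s j * (v j \<bullet> x) else 0)"
      unfolding Mx inner_sum_right using that by (intro sum.cong) (auto simp: uu)
    then show ?thesis
      using that by simp
  qed
  have vX: "v j \<bullet> (X *v y) = inverse (s j) * (u j \<bullet> y)" if "j < r" for j y
  proof -
    have "v j \<bullet> (X *v y) = (\<Sum>i<r. if i = j then inverse (s j) * (u j \<bullet> y) else 0)"
      unfolding Xy inner_sum_right using that by (intro sum.cong) (auto simp: vv)
    then show ?thesis
      using that by simp
  qed
  have MX: "M ** X = (\<Sum>i<r. 1 *\<^sub>R outer (u i) (u i))"
    unfolding matrix_eq outer_sum_mult_vec matrix_vector_mul_assoc[symmetric]
    by (auto simp: Mx[of "X *v _"] vX s intro!: sum.cong)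
  have XM: "X ** M = (\<Sum>i<r. 1 *\<^sub>R outer (v i) (v i))"
    unfolding matrix_eq outer_sum_mult_vec matrix_vector_mul_assoc[symmetric]
    by (auto simp: Xy[of "M *v _"] uM s intro!: sum.cong)
  have "M ** X ** M = M"
    unfolding MX matrix_eq matrix_vector_mul_assoc[symmetric] outer_sum_mult_vec
  proof
    show "(\<Sum>i<r. (1 * (u i \<bullet> (M *v x))) *\<^sub>R u i) = M *v x" for x
      by (subst (2) Mx) (auto simp: uM intro!: sum.cong)
  qed
  moreover have "X ** M ** X = X"
    unfolding XM matrix_eq matrix_vector_mul_assoc[symmetric] outer_sum_mult_vec
  proof
    show "(\<Sum>i<r. (1 * (v i \<bullet> (X *v y))) *\<^sub>R v i) = X *v y" for y
      by (subst (2) Xy) (auto simp: vX intro!: sum.cong)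
  qed
  ultimately show ?thesis
    unfolding X_def[symmetric] penrose_def by (simp only: MX XM transpose_outer_sum)
qed

lemma penrose_unique:
  assumes "penrose M X" "penrose M Y"
  shows "X = Y"
proof -
  have "M ** X = (M ** Y) ** (M ** X)"
    using assms by (metis penrose_def matrix_mul_assoc)
  also have "\<dots> = transpose ((M ** X) ** (M ** Y))"
    using assms by (simp add: penrose_def matrix_transpose_mul)
  also have "(M ** X) ** (M ** Y) = M ** Y"
    using assms by (metis penrose_def matrix_mul_assoc)
  finally have MX: "M ** X = M ** Y"
    using assms by (simp add: penrose_def)
  have "X ** M = (X ** M) ** (Y ** M)"
    using assms by (metis penrose_def matrix_mul_assoc)
  also have "\<dots> = transpose ((Y ** M) ** (X ** M))"
    using assms by (simp add: penrose_def matrix_transpose_mul)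
  also have "(Y ** M) ** (X ** M) = Y ** M"
    using assms by (metis penrose_def matrix_mul_assoc)
  finally have XM: "X ** M = Y ** M"
    using assms by (simp add: penrose_def)
  show ?thesis
    using assms MX XM by (metis penrose_def matrix_mul_assoc)
qed

lemma penrose_pinv: "penrose M (pinv M)"
proof -
  obtain X where "penrose M X"
    using svd_exists[of M] svd_penrose by blast
  then show ?thesis
    unfolding pinv_def by (metis penrose_unique theI)
qed

lemma drls_indices_exists:
  fixes \<tau> :: "'d::finite \<Rightarrow> real"
  shows "\<exists>\<Theta>. drls_indices k \<epsilon> \<tau> \<Theta>"
proof -
  obtain ys where ys: "distinct ys" "set ys = (UNIV :: 'd set)"
    using finite_distinct_list[OF finite] by blast
  define xs where "xs = sort_key (\<lambda>i. - \<tau> i) ys"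
  have "sorted (map (\<lambda>i. - \<tau> i) xs)"
    by (simp add: xs_def)
  then have "sorted_wrt (\<lambda>i j. \<tau> i \<ge> \<tau> j) xs"
    by (simp add: sorted_map)
  moreover have "distinct xs" "set xs = UNIV"
    using ys by (simp_all add: xs_def)
  ultimately show ?thesis
    unfolding drls_indices_def Let_def by blast
qed

end

theory Submission
  imports Defs
begin

text \<open>
  Write \<open>K = A A\<^sup>T + \<lambda> I\<close> with \<open>\<lambda> = \<parallel>A - A\<^sub>k\<parallel>\<^sup>2 / k\<close>.  The ridge score of a column \<open>a\<close> is the
  least nonnegative constant \<open>\<tau>\<close> with \<open>(a \<bullet> x)\<^sup>2 \<le> \<tau> (x \<bullet> K x)\<close> for all \<open>x\<close>; the proof needs this inequality,
  lemma \<open>ridge_score_bound\<close>.  It is the Cauchy-Schwarz inequality for the form \<open>(y, x) \<mapsto> y \<bullet> K x\<close>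
  at \<open>y = K\<^sup>+ a\<close>, as soon as \<open>K y = a\<close>.  The latter holds because \<open>a\<close> is orthogonal to the kernel
  of \<open>K\<close>, which lies in the kernel of \<open>A\<^sup>T\<close>; this also covers \<open>\<lambda> = 0\<close>, where \<open>K\<close> may be singular.

  The quadratic form of \<open>A A\<^sup>T - C C\<^sup>T\<close> at \<open>x\<close> is the sum of \<open>(a\<^sub>i \<bullet> x)\<^sup>2\<close> over the columns that
  are not selected.  It is nonnegative, which is the upper bound on \<open>C C\<^sup>T\<close>.  By the inequality
  above it is at most \<open>x \<bullet> K x\<close> times the total score of these columns, which the
  stopping rule keeps below \<open>\<epsilon>\<close> (lemma \<open>drls_unselected_score\<close>).  Hence
  \<open>A A\<^sup>T - C C\<^sup>T \<preceq> \<epsilon> K\<close>, and this is the lower bound rearranged.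
\<close>

lemma inner_gram_mult:
  fixes M :: "real^'d^'n"
  shows "x \<bullet> ((M ** transpose M) *v x) = (\<Sum>j\<in>UNIV. (column j M \<bullet> x)\<^sup>2)"
proof -
  have "x \<bullet> ((M ** transpose M) *v x) = (transpose M *v x) \<bullet> (transpose M *v x)"
    by (simp only: matrix_vector_mul_assoc[symmetric] inner_transpose)
  also have "\<dots> = (\<Sum>j\<in>UNIV. (column j M \<bullet> x)\<^sup>2)"
    by (simp add: inner_vec_def matrix_vector_mult_def transpose_def column_def power2_eq_square
        del: transpose_matrix_vector)
  finally show ?thesis .
qed

lemma transpose_gram: "transpose (M ** transpose M) = M ** transpose (M :: real^'d^'n)"
  by (simp add: matrix_transpose_mul)

lemma transpose_add: "transpose (F + G) = transpose F + transpose (G :: real^'d^'n)"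
  by (simp add: transpose_def vec_eq_iff)

lemma transpose_diff: "transpose (F - G) = transpose F - transpose (G :: real^'d^'n)"
  by (simp add: transpose_def vec_eq_iff)

lemma transpose_scaleR: "transpose (c *\<^sub>R F) = c *\<^sub>R transpose (F :: real^'d^'n)"
  by (simp add: transpose_def vec_eq_iff)

lemma inner_shifted_gram_mult:
  fixes A :: "real^'d^'n"
  shows "x \<bullet> ((A ** transpose A + c *\<^sub>R mat 1) *v x)
           = (\<Sum>j\<in>UNIV. (column j A \<bullet> x)\<^sup>2) + c * (x \<bullet> x)"
  by (simp add: matrix_vector_mult_add_rdistrib inner_add_right inner_gram_mult
      scaleR_matrix_vector_assoc[symmetric])

lemma psd_shifted_gram:
  fixes A :: "real^'d^'n"
  assumes "0 \<le> c"
  shows "psd (A ** transpose A + c *\<^sub>R mat 1)"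
  unfolding psd_def
  using assms by (auto simp: inner_shifted_gram_mult transpose_add transpose_gram transpose_scaleR
      sum_nonneg)

lemma psd_Cauchy_Schwarz:
  assumes "psd K"
  shows "(y \<bullet> (K *v x))\<^sup>2 \<le> (y \<bullet> (K *v y)) * (x \<bullet> (K *v x))"
proof -
  define p q r where "p = y \<bullet> (K *v y)" and "q = y \<bullet> (K *v x)" and "r = x \<bullet> (K *v x)"
  have "x \<bullet> (K *v y) = q"
    using assms inner_transpose[of K x y] by (simp add: q_def psd_def inner_commute)
  then have form: "(s *\<^sub>R x - t *\<^sub>R y) \<bullet> (K *v (s *\<^sub>R x - t *\<^sub>R y))
      = s\<^sup>2 * r - 2 * s * t * q + t\<^sup>2 * p" for s t
    by (simp add: p_def q_def r_def matrix_vector_mult_diff_distrib matrix_vector_mult_scaleR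
        inner_diff_left inner_diff_right algebra_simps power2_eq_square)
  have nonneg: "0 \<le> s\<^sup>2 * r - 2 * s * t * q + t\<^sup>2 * p" for s t
    using assms form by (metis psd_def)
  have "q\<^sup>2 \<le> p * r"
  proof (cases "p = 0")
    case True
    \<comment> \<open>The form is then affine in \<open>t\<close>, so it can only stay nonnegative if \<open>q = 0\<close>.\<close>
    have "q = 0"
    proof (rule ccontr)
      assume "q \<noteq> 0"
      then show False
        using nonneg[of 1 "(r + 1) / (2 * q)"] True by simp
    qed
    then show ?thesis
      using True by simp
  next
    case False
    then have "0 < p"
      using assms by (simp add: p_def psd_def order_less_le)
    \<comment> \<open>The minimiser \<open>t = q / p\<close> for \<open>s = 1\<close>, scaled by \<open>p\<close> to avoid division.\<close>
    moreover have "0 \<le> p * (p * r - q\<^sup>2)"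
      using nonneg[of p q] by (simp add: algebra_simps power2_eq_square)
    ultimately show ?thesis
      by (simp add: zero_le_mult_iff)
  qed
  then show ?thesis
    by (simp add: p_def q_def r_def)
qed

text \<open>For symmetric \<open>K\<close>, the matrix \<open>K K\<^sup>+\<close> is the orthogonal projection onto the range of \<open>K\<close>,
  which is the orthogonal complement of the kernel of \<open>K\<close>.\<close>

lemma mult_pinv_mult_eq:
  fixes K :: "real^'n^'n"
  assumes sym: "transpose K = K" and orth: "\<And>w. K *v w = 0 \<Longrightarrow> a \<bullet> w = 0"
  shows "K *v (pinv K *v a) = a"
proof -
  define P where "P = K ** pinv K"
  have PK: "P ** K = K" and P: "transpose P = P"
    using penrose_pinv[of K] by (simp_all add: penrose_def P_def)
  have PP: "P ** P = P"
    using PK by (simp add: P_def matrix_mul_assoc)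
  have KP: "K ** P = K"
    using PK P sym by (metis matrix_transpose_mul)
  define w where "w = a - P *v a"
  have "K *v w = 0"
    by (simp add: w_def matrix_vector_mult_diff_distrib matrix_vector_mul_assoc KP)
  then have "a \<bullet> w = 0"
    by (rule orth)
  moreover have "(P *v a) \<bullet> w = 0"
  proof -
    have "P *v w = 0"
      by (simp add: w_def matrix_vector_mult_diff_distrib matrix_vector_mul_assoc PP)
    then show ?thesis
      using inner_transpose[of P a w] P by simp
  qed
  ultimately have "w \<bullet> w = 0"
    by (subst w_def) (simp only: inner_diff_left diff_self)
  then show ?thesis
    by (simp add: w_def P_def matrix_vector_mul_assoc)
qed

lemma column_eq_shifted_gram_mult:
  fixes A :: "real^'d^'n"
  assumes "0 \<le> c"
  defines "K \<equiv> A ** transpose A + c *\<^sub>R mat 1"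
  shows "K *v (pinv K *v column i A) = column i A"
proof (rule mult_pinv_mult_eq)
  show "transpose K = K"
    using psd_shifted_gram[OF assms(1), of A] by (simp add: K_def psd_def)
next
  fix w assume "K *v w = 0"
  then have "(\<Sum>j\<in>UNIV. (column j A \<bullet> w)\<^sup>2) + c * (w \<bullet> w) = 0"
    using inner_shifted_gram_mult[of w A c] by (simp add: K_def)
  moreover have "0 \<le> (\<Sum>j\<in>UNIV. (column j A \<bullet> w)\<^sup>2)" "0 \<le> c * (w \<bullet> w)"
    using assms(1) by (simp_all add: sum_nonneg)
  ultimately have "(\<Sum>j\<in>UNIV. (column j A \<bullet> w)\<^sup>2) = 0"
    by linarith
  then show "column i A \<bullet> w = 0"
    by (simp add: sum_nonneg_eq_0_iff)
qed

context
  fixes A B :: "real^'d^'n" and k :: nat and K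
  defines "K \<equiv> A ** transpose A + (1 / real k * (norm (A - B))\<^sup>2) *\<^sub>R mat 1"
begin

lemma psd_ridge_matrix: "psd K"
  unfolding K_def by (rule psd_shifted_gram) simp

text \<open>With \<open>y = K\<^sup>+ a\<close> and \<open>K y = a\<close>, the score of \<open>a\<close> is a value of the quadratic form of \<open>K\<close>.\<close>

lemma ridge_score_eq:
  "ridge_score k A B i = (pinv K *v column i A) \<bullet> (K *v (pinv K *v column i A))"
proof -
  have "K *v (pinv K *v column i A) = column i A"
    unfolding K_def by (rule column_eq_shifted_gram_mult) simp
  then show ?thesis
    by (simp add: ridge_score_def K_def inner_commute)
qed

lemma ridge_score_nonneg: "0 \<le> ridge_score k A B i"
  using psd_ridge_matrix by (simp add: ridge_score_eq psd_def)

text \<open>Cauchy-Schwarz for the form of \<open>K\<close> at \<open>y = K\<^sup>+ a\<close>, since \<open>a \<bullet> x = y \<bullet> K x\<close>.\<close>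

lemma ridge_score_bound:
  "(column i A \<bullet> x)\<^sup>2 \<le> ridge_score k A B i * (x \<bullet> (K *v x))"
proof -
  let ?y = "pinv K *v column i A"
  have "column i A = K *v ?y"
    unfolding K_def by (rule column_eq_shifted_gram_mult[symmetric]) simp
  then have "column i A \<bullet> x = ?y \<bullet> (K *v x)"
    using inner_transpose[of K ?y x] psd_ridge_matrix by (metis psd_def)
  then show ?thesis
    using psd_Cauchy_Schwarz[OF psd_ridge_matrix, of ?y x] by (simp add: ridge_score_eq)
qed

end

text \<open>The threshold is reached because \<open>\<epsilon> > 0\<close> and the list contains all columns, so the least
  \<open>m\<close> does satisfy the stopping condition.  Columns added afterwards to reach \<open>k\<close> of them can
  only lower the remaining score, as scores are nonnegative.\<close>

lemma drls_unselected_score: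
  fixes \<tau> :: "'d::finite \<Rightarrow> real"
  assumes "drls_indices k \<epsilon> \<tau> \<Theta>" "0 < \<epsilon>" and nonneg: "\<And>i. 0 \<le> \<tau> i"
  shows "(\<Sum>i\<in>-\<Theta>. \<tau> i) < \<epsilon>"
proof -
  define stop where "stop xs m \<longleftrightarrow> (\<Sum>i\<in>set (take m xs). \<tau> i) > (\<Sum>i\<in>UNIV. \<tau> i) - \<epsilon>" for xs m
  obtain xs where xs: "set xs = UNIV" and \<Theta>: "\<Theta> = set (take (max (Least (stop xs)) k) xs)"
    using assms(1) by (auto simp: drls_indices_def Let_def stop_def[abs_def])
  have "stop xs (length xs)"
    using xs assms(2) by (simp add: stop_def)
  then have "stop xs (Least (stop xs))"
    by (rule LeastI)
  then have "(\<Sum>i\<in>UNIV. \<tau> i) - \<epsilon> < (\<Sum>i\<in>set (take (Least (stop xs)) xs). \<tau> i)"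
    by (simp add: stop_def)
  also have "\<dots> \<le> (\<Sum>i\<in>\<Theta>. \<tau> i)"
    unfolding \<Theta> by (intro sum_mono2 set_take_subset_set_take nonneg) auto
  finally show ?thesis
    by (simp add: Compl_eq_Diff_UNIV sum_diff)
qed

lemma inner_gram_diff_column_submatrix:
  fixes A :: "real^'d^'n" and \<sigma> :: "'m::finite \<Rightarrow> 'd"
  assumes "bij_betw \<sigma> UNIV \<Theta>"
  defines "C \<equiv> (\<chi> i j. A $ i $ \<sigma> j) :: real^'m^'n"
  shows "x \<bullet> ((A ** transpose A - C ** transpose C) *v x) = (\<Sum>i\<in>-\<Theta>. (column i A \<bullet> x)\<^sup>2)"
proof -
  have "column j C = column (\<sigma> j) A" for j
    by (simp add: C_def column_def)
  then have "x \<bullet> ((C ** transpose C) *v x) = (\<Sum>i\<in>\<Theta>. (column i A \<bullet> x)\<^sup>2)"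
    using sum.reindex_bij_betw[OF assms(1), of "\<lambda>i. (column i A \<bullet> x)\<^sup>2"]
    by (simp add: inner_gram_mult)
  then show ?thesis
    by (simp add: matrix_vector_mult_diff_rdistrib inner_diff_right inner_gram_mult
        Compl_eq_Diff_UNIV sum_diff)
qed

theorem theorem1:
  fixes A A\<^sub>k :: "real^'d^'n" and C :: "real^'m^'n" and k :: nat and \<epsilon> :: real
  assumes "k \<ge> 1"
    and "rank A \<ge> k"
    and "\<epsilon> > 0"
    and "truncated_svd k A A\<^sub>k"
    and "drls_output k \<epsilon> A A\<^sub>k C"
  shows "(1 - \<epsilon>) *\<^sub>R (A ** transpose A) - (\<epsilon> / real k * (norm (A - A\<^sub>k))\<^sup>2) *\<^sub>R mat 1
           \<preceq> C ** transpose C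
       \<and> C ** transpose C \<preceq> A ** transpose A"
proof -
  define K where "K = A ** transpose A + (1 / real k * (norm (A - A\<^sub>k))\<^sup>2) *\<^sub>R mat 1"
  define D where "D = A ** transpose A - C ** transpose C"
  let ?\<tau> = "ridge_score k A A\<^sub>k"
  obtain \<Theta> \<sigma> where \<Theta>: "drls_indices k \<epsilon> ?\<tau> \<Theta>" and \<sigma>: "bij_betw \<sigma> (UNIV :: 'm set) \<Theta>"
    and C: "C = (\<chi> i j. A $ i $ \<sigma> j)"
    using assms(5) by (auto simp: drls_output_def)
  have K: "psd K"
    unfolding K_def by (rule psd_ridge_matrix)
  have D: "x \<bullet> (D *v x) = (\<Sum>i\<in>-\<Theta>. (column i A \<bullet> x)\<^sup>2)" for x
    unfolding D_def C by (rule inner_gram_diff_column_submatrix[OF \<sigma>])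
  have sym: "transpose D = D"
    by (simp add: D_def transpose_diff transpose_gram)
  have bound: "x \<bullet> (D *v x) \<le> \<epsilon> * (x \<bullet> (K *v x))" for x
  proof -
    have "x \<bullet> (D *v x) \<le> (\<Sum>i\<in>-\<Theta>. ?\<tau> i * (x \<bullet> (K *v x)))"
      unfolding D K_def by (intro sum_mono ridge_score_bound)
    also have "\<dots> = (\<Sum>i\<in>-\<Theta>. ?\<tau> i) * (x \<bullet> (K *v x))"
      by (simp add: sum_distrib_right)
    also have "\<dots> \<le> \<epsilon> * (x \<bullet> (K *v x))"
      using drls_unselected_score[OF \<Theta> assms(3) ridge_score_nonneg] K
      by (intro mult_right_mono) (simp_all add: psd_def)
    finally show ?thesis .
  qed
  have "psd (\<epsilon> *\<^sub>R K - D)"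
    using bound K sym
    by (simp add: psd_def transpose_diff transpose_scaleR matrix_vector_mult_diff_rdistrib
        scaleR_matrix_vector_assoc[symmetric] inner_diff_right)
  moreover have "\<epsilon> *\<^sub>R K - D = C ** transpose C
      - ((1 - \<epsilon>) *\<^sub>R (A ** transpose A) - (\<epsilon> / real k * (norm (A - A\<^sub>k))\<^sup>2) *\<^sub>R mat 1)"
    by (simp add: K_def D_def algebra_simps)
  moreover have "psd D"
    using sym by (simp add: psd_def D sum_nonneg)
  ultimately show ?thesis
    unfolding loewner_le_def D_def by (simp only:)
qed

end
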